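(* Let $G$ be a connected finite simple graph with chromatic number $\chi(G)$ and independence number $\alpha(G)$. Then $$\chi_{md}(G)\leq \chi(G)+\left\lceil \frac{\alpha(G)}{2}\right\rceil-1.$$ Moreover, the bound is sharp: there exist connected graphs for which equality holds.
   Context: All graphs are finite and simple. For a vertex $v$, $N[v]=N(v)\cup\{v\}$ is its closed neighborhood; $v$ dominates exactly the vertices of $N[v]$. A majority dominator coloring of $G$ is a proper vertex coloring of $G$ such that for every vertex $v$ there is a color class $C$ with $|N[v]\cap C|\geq |C|/2$ (i.e. $v$ dominates at least half of some color class; this may be its own class, which then has at most two vertices). The majority dominator chromatic number $\chi_{md}(G)$ is the minimum number of color classes in a majority dominator coloring of $G$. $\alpha(G)$ is the maximum size of an independent set. *)

theory Defs
  imports Complex_Main "Graph_Theory.Graph_Theory"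
begin

text \<open>
  A finite simple graph is a \<^locale>\<open>pair_graph\<close>: a finite, loop-free, symmetric digraph
  whose arcs are ordered pairs of vertices, so that the edge \<open>uv\<close> is the pair of arcs
  \<open>(u, v)\<close> and \<open>(v, u)\<close>.
\<close>

definition closed_neighborhood :: "'a pair_pre_digraph \<Rightarrow> 'a \<Rightarrow> 'a set" where
  "closed_neighborhood G v = insert v {u. (v, u) \<in> parcs G}"

definition independent_in :: "'a pair_pre_digraph \<Rightarrow> 'a set \<Rightarrow> bool" where
  "independent_in G S \<longleftrightarrow> S \<subseteq> pverts G \<and> (\<forall>u\<in>S. \<forall>v\<in>S. (u, v) \<notin> parcs G)"

definition independence_number :: "'a pair_pre_digraph \<Rightarrow> nat" where
  "independence_number G = Max (card ` {S. independent_in G S})"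

text \<open>
  Colors are natural numbers; only the values on the vertices of the graph matter. Only colors
  that are actually used give rise to a color class, so color classes are nonempty.
\<close>

definition proper_coloring :: "'a pair_pre_digraph \<Rightarrow> ('a \<Rightarrow> nat) \<Rightarrow> bool" where
  "proper_coloring G c \<longleftrightarrow> (\<forall>(u, v)\<in>parcs G. c u \<noteq> c v)"

definition color_classes :: "'a pair_pre_digraph \<Rightarrow> ('a \<Rightarrow> nat) \<Rightarrow> 'a set set" where
  "color_classes G c = (\<lambda>i. {v \<in> pverts G. c v = i}) ` (c ` pverts G)"

definition chromatic_number :: "'a pair_pre_digraph \<Rightarrow> nat" where
  "chromatic_number G = (LEAST k. \<exists>c. proper_coloring G c \<and> card (color_classes G c) = k)"

definition majority_dominator_coloring :: "'a pair_pre_digraph \<Rightarrow> ('a \<Rightarrow> nat) \<Rightarrow> bool" where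
  "majority_dominator_coloring G c \<longleftrightarrow>
     proper_coloring G c \<and>
     (\<forall>v\<in>pverts G. \<exists>C\<in>color_classes G c.
        real (card (closed_neighborhood G v \<inter> C)) \<ge> real (card C) / 2)"

text \<open>
  In a finite graph a coloring with pairwise distinct colors is a majority dominator coloring,
  so both minima are taken over nonempty sets.
\<close>

definition majority_dominator_chromatic_number :: "'a pair_pre_digraph \<Rightarrow> nat" where
  "majority_dominator_chromatic_number G =
     (LEAST k. \<exists>c. majority_dominator_coloring G c \<and> card (color_classes G c) = k)"

end

theory Submission
  imports Defs
begin

text \<open>
  Extend one color class of an optimal proper coloring to a maximal independent set \<open>I\<close>.
  Deleting \<open>I\<close> makes a color superfluous, and \<open>I\<close>, being maximal, is dominating. Recoloring \<open>I\<close>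
  by \<open>\<lceil>card I / 2\<rceil>\<close> new colors, each used at most twice, lets every vertex dominate half of a
  new class.
\<close>

lemma ceiling_half_nat: "\<lceil>real n / 2\<rceil> = int ((n + 1) div 2)"
proof (cases "even n")
  case True
  then obtain m where "n = 2 * m" ..
  then show ?thesis by simp
next
  case False
  then obtain m where "n = 2 * m + 1" ..
  then show ?thesis by (simp add: ceiling_eq_iff)
qed

lemma card_color_classes: "card (color_classes G c) = card (c ` pverts G)"
  unfolding color_classes_def by (rule card_image) (auto simp: inj_on_def)

text \<open>Halving an injective numbering groups the consecutive numbers \<open>2 * j\<close> and
  \<open>2 * j + 1\<close>. This is how an independent set gets split into classes of at most two
  vertices.\<close>

lemma card_pairing_fiber_le_2:
  fixes e :: "'a \<Rightarrow> nat"
  assumes "inj_on e A"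
  shows "card {u \<in> A. e u div 2 = j} \<le> 2"
proof -
  have "e ` {u \<in> A. e u div 2 = j} \<subseteq> {2 * j, 2 * j + 1}"
    by auto
  then have "card (e ` {u \<in> A. e u div 2 = j}) \<le> card {2 * j, 2 * j + 1}"
    by (intro card_mono) auto
  moreover have "inj_on e {u \<in> A. e u div 2 = j}"
    using assms by (rule inj_on_subset) auto
  ultimately show ?thesis
    by (simp add: card_image)
qed

context pair_graph
begin

lemma finite_independent_sets: "finite {S. independent_in G S}"
  by (rule finite_subset[of _ "Pow (pverts G)"]) (auto simp: independent_in_def)

lemma card_le_independence_number:
  assumes "independent_in G S"
  shows "card S \<le> independence_number G"
  unfolding independence_number_def using assms finite_independent_sets
  by (intro Max_ge) auto

lemma chromatic_number_attained:
  obtains c where "proper_coloring G c" and "card (c ` pverts G) = chromatic_number G"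
proof -
  \<comment> \<open>\<open>LEAST\<close> says something only once a witness exists. An injective
    numbering of the finite vertex set is one, because without loops adjacent vertices are
    distinct.\<close>
  obtain e :: "'a \<Rightarrow> nat" where e: "inj_on e (pverts G)"
    using finite_imp_inj_to_nat_seg[OF pair_finite_verts] by blast
  have "e u \<noteq> e v" if "(u, v) \<in> parcs G" for u v
  proof -
    have "u \<noteq> v"
      using that no_loops'[OF that] by auto
    moreover have "u \<in> pverts G" "v \<in> pverts G"
      using that in_arcsD1 in_arcsD2 by auto
    ultimately show ?thesis
      using e by (auto dest: inj_onD)
  qed
  then have "proper_coloring G e"
    by (auto simp: proper_coloring_def)
  then have "\<exists>k c. proper_coloring G c \<and> card (color_classes G c) = k"
    by blast
  from LeastI_ex[OF this] show ?thesis
    using that by (auto simp: chromatic_number_def card_color_classes)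
qed

lemma independent_in_color_class:
  assumes "proper_coloring G c"
  shows "independent_in G {v \<in> pverts G. c v = i}"
  using assms by (auto simp: independent_in_def proper_coloring_def)

text \<open>Take \<open>I\<close> inclusion-maximal among the independent sets above
  \<open>S\<close>. A vertex with no closed neighbor in \<open>I\<close> could be added to
  \<open>I\<close>, contradicting maximality.\<close>

lemma dominating_independent_superset:
  assumes "independent_in G S"
  obtains I where "independent_in G I" and "S \<subseteq> I"
    and "\<And>v. v \<in> pverts G \<Longrightarrow> closed_neighborhood G v \<inter> I \<noteq> {}"
proof -
  obtain I where I: "independent_in G I" "S \<subseteq> I"
    and maximal: "\<And>J. independent_in G J \<Longrightarrow> I \<subseteq> J \<Longrightarrow> J = I"
    using finite_has_maximal2[OF finite_independent_sets, of S] assms by auto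
  have "closed_neighborhood G v \<inter> I \<noteq> {}" if v: "v \<in> pverts G" for v
  proof
    assume none: "closed_neighborhood G v \<inter> I = {}"
    then have "v \<notin> I" and out: "\<And>u. u \<in> I \<Longrightarrow> (v, u) \<notin> parcs G"
      by (auto simp: closed_neighborhood_def)
    \<comment> \<open>Independence concerns arcs in both directions, while \<open>out\<close> covers
      only those leaving \<open>v\<close>; symmetry gives the others.\<close>
    moreover have "(u, v) \<notin> parcs G" if "u \<in> I" for u
      using out[OF that] arcs_symmetric by auto
    moreover have "(v, v) \<notin> parcs G"
      using no_loops' by blast
    ultimately have "independent_in G (insert v I)"
      using I v by (auto simp: independent_in_def)
    with maximal \<open>v \<notin> I\<close> show False
      by blast
  qed
  with I that show ?thesis
    by blast
qed

text \<open>The bound over the naturals: \<open>(n + 1) div 2\<close> is the rounded-up half of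
  \<open>n\<close>, and the subtraction does not truncate because a nonempty graph needs a
  color.\<close>

lemma majority_dominator_chromatic_number_le:
  assumes "pverts G \<noteq> {}"
  shows "majority_dominator_chromatic_number G
           \<le> chromatic_number G - 1 + (independence_number G + 1) div 2"
proof -
  obtain c where c: "proper_coloring G c" "card (c ` pverts G) = chromatic_number G"
    by (rule chromatic_number_attained)
  obtain v0 where v0: "v0 \<in> pverts G"
    using assms by blast
  obtain I where I: "independent_in G I" "{v \<in> pverts G. c v = c v0} \<subseteq> I"
    and dom: "\<And>v. v \<in> pverts G \<Longrightarrow> closed_neighborhood G v \<inter> I \<noteq> {}"
    using dominating_independent_superset[OF independent_in_color_class[OF c(1)]] by blast
  have I_sub: "I \<subseteq> pverts G"
    using I(1) by (simp add: independent_in_def)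
  then have fin_I: "finite I"
    using pair_finite_verts by (rule finite_subset)
  then obtain e :: "'a \<Rightarrow> nat" where e: "inj_on e I" "e ` I = {..<card I}"
    using finite_imp_inj_to_nat_seg[OF fin_I] card_image
    by (metis card_Collect_less_nat lessThan_def)
  \<comment> \<open>Odd colors inside \<open>I\<close> and even colors outside keep the new colors
    apart from the old ones; \<open>e v div 2\<close> pairs up the vertices of
    \<open>I\<close>.\<close>
  define d where "d v = (if v \<in> I then 2 * (e v div 2) + 1 else 2 * c v)" for v
  have d_eq_I: "{u \<in> pverts G. d u = d v} = {u \<in> I. e u div 2 = e v div 2}" if "v \<in> I" for v
    using that I_sub by (auto simp: d_def split: if_splits) presburger+
  have "d u \<noteq> d v" if "(u, v) \<in> parcs G" for u v
  proof -
    have "c u \<noteq> c v"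
      using c(1) that by (auto simp: proper_coloring_def)
    moreover have "\<not> (u \<in> I \<and> v \<in> I)"
      using I(1) that by (auto simp: independent_in_def)
    \<comment> \<open>At most one end lies in \<open>I\<close>: if exactly one does, parity
      separates the colors; if none does, \<open>c\<close> separates them.\<close>
    ultimately show ?thesis
      by (auto simp: d_def) presburger+
  qed
  then have "proper_coloring G d"
    by (auto simp: proper_coloring_def)
  moreover have "\<exists>C\<in>color_classes G d.
      real (card C) / 2 \<le> real (card (closed_neighborhood G v \<inter> C))" if v: "v \<in> pverts G" for v
  proof -
    \<comment> \<open>The class of \<open>w\<close> has at most two vertices and \<open>v\<close>
      dominates at least \<open>w\<close> itself, hence at least half of it.\<close>
    obtain w where w: "w \<in> closed_neighborhood G v" "w \<in> I"
      using dom[OF v] by blast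
    let ?C = "{u \<in> pverts G. d u = d w}"
    have "card ?C \<le> 2"
      unfolding d_eq_I[OF w(2)] using e(1) by (rule card_pairing_fiber_le_2)
    moreover have "0 < card (closed_neighborhood G v \<inter> ?C)"
      using w I_sub by (auto simp: card_gt_0_iff)
    ultimately have "real (card ?C) / 2 \<le> real (card (closed_neighborhood G v \<inter> ?C))"
      by linarith
    moreover have "?C \<in> color_classes G d"
      using w(2) I_sub by (auto simp: color_classes_def)
    ultimately show ?thesis
      by blast
  qed
  ultimately have "majority_dominator_coloring G d"
    by (simp add: majority_dominator_coloring_def)
  then have "majority_dominator_chromatic_number G \<le> card (color_classes G d)"
    unfolding majority_dominator_chromatic_number_def by (intro Least_le) blast
  also have "\<dots> = card (d ` pverts G)"
    by (rule card_color_classes)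
  \<comment> \<open>The even color of \<open>c v0\<close> disappears, since its whole class lies in
    \<open>I\<close>. The numbers on \<open>I\<close> are below \<open>card I\<close>, so their
    halves take at most \<open>(card I + 1) div 2\<close> values.\<close>
  also have "\<dots> \<le> card ((\<lambda>i. 2 * i) ` (c ` pverts G - {c v0})
      \<union> (\<lambda>j. 2 * j + 1) ` {..<(card I + 1) div 2})"
  proof (rule card_mono)
    have "e v div 2 < (card I + 1) div 2" if "v \<in> I" for v
    proof -
      have "e v < card I"
        using e(2) that by auto
      then show ?thesis
        by linarith
    qed
    then show "d ` pverts G \<subseteq> (\<lambda>i. 2 * i) ` (c ` pverts G - {c v0})
        \<union> (\<lambda>j. 2 * j + 1) ` {..<(card I + 1) div 2}"
      using I(2) by (auto simp: d_def)
  qed (use pair_finite_verts in auto)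
  also have "\<dots> \<le> card (c ` pverts G - {c v0}) + card {..<(card I + 1) div 2}"
    by (rule order_trans[OF card_Un_le add_mono]; intro card_image_le)
      (use pair_finite_verts in auto)
  \<comment> \<open>Since \<open>v0\<close> is a vertex, \<open>c v0\<close> is a used color, so
    removing it saves exactly one.\<close>
  also have "\<dots> = chromatic_number G - 1 + (card I + 1) div 2"
    using c(2) v0 pair_finite_verts by (simp add: card_Diff_singleton)
  also have "\<dots> \<le> chromatic_number G - 1 + (independence_number G + 1) div 2"
    using card_le_independence_number[OF I(1)] by (intro add_left_mono div_le_mono) simp
  finally show ?thesis .
qed

text \<open>Turns the truncated \<open>chromatic_number G - 1\<close> into the integer difference of
  the final bound.\<close>

lemma chromatic_number_pos:
  assumes "pverts G \<noteq> {}"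
  shows "0 < chromatic_number G"
proof -
  obtain c where "proper_coloring G c" "card (c ` pverts G) = chromatic_number G"
    by (rule chromatic_number_attained)
  moreover have "0 < card (c ` pverts G)"
    using assms pair_finite_verts by (simp add: card_gt_0_iff)
  ultimately show ?thesis
    by simp
qed

end

text \<open>Witness for sharpness: all three parameters are 1, and 1 = 1 + 1 - 1.\<close>

definition one_vertex_graph :: "nat pair_pre_digraph" where
  "one_vertex_graph = \<lparr>pverts = {0}, parcs = {}\<rparr>"

lemma pair_graph_one_vertex: "pair_graph one_vertex_graph"
  by unfold_locales
    (auto simp: one_vertex_graph_def arcs_ends_def arc_to_ends_def symmetric_def sym_def)

lemma connected_one_vertex: "Digraph_Component.connected (with_proj one_vertex_graph)"
  unfolding connected_def strongly_connected_def
  by (auto simp: one_vertex_graph_def reachable_def mk_symmetric_def intro: rtrancl_on_refl)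

text \<open>As the count is the same for every \<open>c\<close>, both chromatic numbers are 1 as
  soon as one admissible coloring exists.\<close>

lemma card_color_classes_one_vertex: "card (color_classes one_vertex_graph c) = 1"
  by (simp add: card_color_classes one_vertex_graph_def)

lemma chromatic_number_one_vertex: "chromatic_number one_vertex_graph = 1"
  unfolding chromatic_number_def card_color_classes_one_vertex
  by (rule Least_equality) (auto simp: proper_coloring_def one_vertex_graph_def)

lemma majority_dominator_chromatic_number_one_vertex:
  "majority_dominator_chromatic_number one_vertex_graph = 1"
proof -
  have "majority_dominator_coloring one_vertex_graph c" for c
  proof -
    have "color_classes one_vertex_graph c = {{0}}"
      by (auto simp: color_classes_def one_vertex_graph_def)
    then show ?thesis
      by (simp add: majority_dominator_coloring_def proper_coloring_def closed_neighborhood_def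
          one_vertex_graph_def)
  qed
  then show ?thesis
    unfolding majority_dominator_chromatic_number_def card_color_classes_one_vertex
    by (auto intro: Least_equality)
qed

lemma independence_number_one_vertex: "independence_number one_vertex_graph = 1"
proof -
  have "{S. independent_in one_vertex_graph S} = {{}, {0}}"
    by (auto simp: independent_in_def one_vertex_graph_def)
  then show ?thesis
    by (simp add: independence_number_def)
qed

theorem theorem2p1:
  shows "(\<forall>G :: 'a pair_pre_digraph. pair_graph G \<and> Digraph_Component.connected (with_proj G) \<longrightarrow>
            int (majority_dominator_chromatic_number G)
              \<le> int (chromatic_number G) + \<lceil>real (independence_number G) / 2\<rceil> - 1) \<and>
         (\<exists>G :: nat pair_pre_digraph. pair_graph G \<and> Digraph_Component.connected (with_proj G) \<and>
            int (majority_dominator_chromatic_number G)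
              = int (chromatic_number G) + \<lceil>real (independence_number G) / 2\<rceil> - 1)"
proof (intro conjI allI impI exI[of _ one_vertex_graph])
  fix G :: "'a pair_pre_digraph"
  assume G: "pair_graph G \<and> Digraph_Component.connected (with_proj G)"
  \<comment> \<open>Connectedness includes having at least one vertex.\<close>
  then have "pverts G \<noteq> {}"
    by (auto simp: connected_def strongly_connected_def)
  with G show "int (majority_dominator_chromatic_number G)
      \<le> int (chromatic_number G) + \<lceil>real (independence_number G) / 2\<rceil> - 1"
    using pair_graph.majority_dominator_chromatic_number_le[of G]
      pair_graph.chromatic_number_pos[of G]
    unfolding ceiling_half_nat by linarith
next
  show "int (majority_dominator_chromatic_number one_vertex_graph)
      = int (chromatic_number one_vertex_graph)
        + \<lceil>real (independence_number one_vertex_graph) / 2\<rceil> - 1"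
    unfolding chromatic_number_one_vertex majority_dominator_chromatic_number_one_vertex
      independence_number_one_vertex ceiling_half_nat by simp
qed (rule pair_graph_one_vertex connected_one_vertex)+

end
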